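(* Let $m$ be a positive integer and let $\gamma=\gamma_1\cdots\gamma_m\in\mathcal S_m(132)$ be any permutation with $\gamma_1=m-1$, $\gamma_{m-1}=m$ and $\gamma_m=1$. Let $B=B(t,x)=\sum_{n\ge 0}t^n\sum_{\sigma\in\mathcal S_n(132)}x^{\gamma\text{-mch}(\sigma)}$. Then $B$ satisfies the recursion $$B=\frac{tB^{3}}{B-1}+t^{m-3}(x-1)(B-1-tB).$$
   Context: $\mathcal S_n$ is the set of permutations of $\{1,\dots,n\}$ in one-line notation ($\mathcal S_0$ contains only the empty permutation, on which all statistics are $0$). For a word $w$ of distinct integers, $\mathrm{red}(w)$ replaces the $i$-th smallest letter by $i$. $\sigma\in\mathcal S_n$ avoids $\lambda\in\mathcal S_k$ (classical avoidance) if no (not necessarily contiguous) subsequence $\sigma_{i_1}\cdots\sigma_{i_k}$, $i_1<\dots<i_k$, has reduction $\lambda$; $\mathcal S_n(\lambda)$ is the set of such $\sigma$. $\gamma\text{-mch}(\sigma)$ is the number of $i$ with $\mathrm{red}(\sigma_i\sigma_{i+1}\cdots\sigma_{i+k-1})=\gamma$ for $\gamma\in\mathcal S_k$.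
   Formalization: The case m = 3 (where γ = 231) is excluded, since the recursion fails there: after multiplying by B − 1, the coefficients of t^4 on the two sides are 20+8x and 21+6x+x^2. *)

theory Defs
  imports
    "HOL-Library.Sublist"
    "HOL-Combinatorics.Multiset_Permutations"
    "HOL-Computational_Algebra.Computational_Algebra"
begin

text \<open>
  Permutations are lists in one-line notation: the library set
  \<open>permutations_of_set {1..n}\<close> of lists plays the role of \<open>S\<^sub>n\<close>. List indices start
  at 0, so the letter at position \<open>i\<close> of a permutation \<open>\<sigma>\<close> is \<open>\<sigma> ! (i - 1)\<close>.
\<close>

definition red :: "nat list \<Rightarrow> nat list" where
  "red w = map (\<lambda>a. card {b \<in> set w. b \<le> a}) w"

definition avoids :: "nat list \<Rightarrow> nat list \<Rightarrow> bool" where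
  "avoids \<sigma> pat \<longleftrightarrow> \<not> (\<exists>w. subseq w \<sigma> \<and> red w = pat)"

definition avoiding_perms :: "nat \<Rightarrow> nat list \<Rightarrow> nat list set" where
  "avoiding_perms n pat = {\<sigma> \<in> permutations_of_set {1..n}. avoids \<sigma> pat}"

text \<open>Matches are consecutive; each is recorded by its 0-based starting position.\<close>

definition mch :: "nat list \<Rightarrow> nat list \<Rightarrow> nat" where
  "mch \<gamma> \<sigma> = card {i. i < length \<sigma> \<and> i + length \<gamma> \<le> length \<sigma> \<and>
                        red (take (length \<gamma>) (drop i \<sigma>)) = \<gamma>}"

text \<open>
  A formal power series in \<open>t\<close> whose coefficients are polynomials in \<open>x\<close>. The pattern
  231 (length 3) is exceptional: there the series is 1 + t + 2t^2 + (4+x)t^3 + (8+6x)t^4 + ...,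
  and the recursion that holds for the longer patterns already fails at t^4 (after
  multiplication by B - 1), the two sides differing by (x-1)^2.
\<close>

definition mch_gf :: "nat list \<Rightarrow> int poly fps" where
  "mch_gf \<gamma> = Abs_fps (\<lambda>n. \<Sum>\<sigma>\<in>avoiding_perms n [1, 3, 2]. monom 1 (mch \<gamma> \<sigma>))"

text \<open>
  Identities involving a quotient live in the fraction field of \<open>\<int>[x][[t]]\<close>; the following
  are the images there of the generating function and of the two indeterminates.
\<close>

abbreviation gf_B :: "nat list \<Rightarrow> int poly fps fract" where
  "gf_B \<gamma> \<equiv> to_fract (mch_gf \<gamma>)"

abbreviation var_t :: "int poly fps fract" where
  "var_t \<equiv> to_fract fps_X"

abbreviation var_x :: "int poly fps fract" where
  "var_x \<equiv> to_fract (fps_const (monom 1 1))"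

end

theory Submission
  imports Defs
begin

text \<open>
  Write $m = k + 3$, $\gamma = p_2 1$ and $p_2 = p_1 m$, and let $E$ and $F$ be the generating functions
  of the 132-avoiders ending in a consecutive occurrence of $p_1$ and of $p_2$. A 132-avoider splits
  around its maximum $n$ as $\alpha n \beta$ with every letter of $\alpha$ above every letter of $\beta$. An
  occurrence of $\gamma$ through $n$ must use $n$ as its largest letter, so it exists iff $\alpha$ ends in $p_1$
  and $\beta$ is nonempty. With $y = x - 1$ this gives
  $B = 1 + t(B^2 + yE(B-1))$ and $F = t(E + BF + yEF)$. Moreover, a 132-avoider ending in such an
  occurrence of $p_1$ is an arbitrary nonempty 132-avoider $\rho$ shifted above the last $k > 0$ letters; the only possible
  new occurrence of $\gamma$ arises when $\rho$ ends in $p_2$, so $E = t^k(B - 1 + yF)$. Eliminating $E$ and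
  $F$ gives the recursion.
\<close>

subsection \<open>Order isomorphism of words\<close>

text \<open>Comparing letters by position avoids the cardinalities in \<open>red\<close> and passes
  easily to factors and concatenations; on distinct words it amounts to equal reductions.\<close>

definition order_iso :: "nat list \<Rightarrow> nat list \<Rightarrow> bool" where
  "order_iso u v \<longleftrightarrow> length u = length v \<and>
     (\<forall>i<length u. \<forall>j<length u. u ! i < u ! j \<longleftrightarrow> v ! i < v ! j)"

lemma order_iso_length: "order_iso u v \<Longrightarrow> length u = length v"
  by (simp add: order_iso_def)

lemma order_iso_nth_less:
  "order_iso u v \<Longrightarrow> i < length v \<Longrightarrow> j < length v \<Longrightarrow> u ! i < u ! j \<longleftrightarrow> v ! i < v ! j"
  by (simp add: order_iso_def)

text \<open>Counting positions instead of values, possible because indexing a distinct word is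
  injective, makes the entries of \<open>red w\<close> depend on comparisons alone.\<close>

lemma red_nth:
  assumes "distinct w" "i < length w"
  shows "red w ! i = card {j. j < length w \<and> w ! j \<le> w ! i}"
proof -
  have "{b \<in> set w. b \<le> w ! i} = (!) w ` {j. j < length w \<and> w ! j \<le> w ! i}"
    by (auto simp: in_set_conv_nth)
  moreover have "inj_on ((!) w) {j. j < length w \<and> w ! j \<le> w ! i}"
    using assms(1) by (auto simp: inj_on_def nth_eq_iff_index_eq)
  ultimately show ?thesis
    using assms(2) by (simp add: red_def card_image)
qed

lemma order_iso_imp_red_eq:
  assumes "order_iso u v" "distinct u" "distinct v"
  shows "red u = red v"
proof (rule nth_equalityI)
  show "length (red u) = length (red v)"
    using assms(1) by (simp add: red_def order_iso_length)
next
  fix i assume "i < length (red u)"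
  hence i: "i < length u" "i < length v"
    using assms(1) by (simp_all add: red_def order_iso_length)
  have "{j. j < length u \<and> u ! j \<le> u ! i} = {j. j < length v \<and> v ! j \<le> v ! i}"
    using assms(1) i unfolding order_iso_def by (auto simp flip: not_less)
  thus "red u ! i = red v ! i"
    using i assms by (simp add: red_nth)
qed

lemma order_iso_red:
  assumes "distinct w"
  shows "order_iso w (red w)"
proof -
  have "red w ! i < red w ! j" if "w ! i < w ! j" "i < length w" "j < length w" for i j
  proof -
    have "{b \<in> set w. b \<le> w ! i} \<subset> {b \<in> set w. b \<le> w ! j}"
      using that by (intro psubsetI subsetI notI) (auto simp: set_eq_iff dest!: spec[of _ "w ! j"])
    hence "card {b \<in> set w. b \<le> w ! i} < card {b \<in> set w. b \<le> w ! j}"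
      by (intro psubset_card_mono) auto
    thus ?thesis using that by (simp add: red_def)
  qed
  thus ?thesis
    using assms unfolding order_iso_def
    by (metis (no_types, lifting) length_map not_less_iff_gr_or_eq nth_eq_iff_index_eq red_def)
qed

lemma red_permutation:
  assumes "\<sigma> \<in> permutations_of_set {1..n}"
  shows "red \<sigma> = \<sigma>"
proof -
  have "{b \<in> set \<sigma>. b \<le> a} = {1..a}" if "a \<in> set \<sigma>" for a
    using assms that by (auto simp: permutations_of_set_def)
  thus ?thesis by (simp add: red_def map_idI)
qed

lemma red_eq_iff_order_iso:
  assumes "distinct w" "p \<in> permutations_of_set {1..n}"
  shows "red w = p \<longleftrightarrow> order_iso w p"
  using assms order_iso_red[OF assms(1)] order_iso_imp_red_eq[of w p] red_permutation[OF assms(2)]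
  by (auto simp: permutations_of_set_def)

text \<open>Reduction fixes permutations, so each order-isomorphism class contains at most one. This
  is how the exact word \<tau> is recovered later.\<close>

lemma order_iso_permutations_eq:
  assumes "order_iso u v" "u \<in> permutations_of_set {1..k}" "v \<in> permutations_of_set {1..l}"
  shows "u = v"
  by (metis assms order_iso_imp_red_eq red_permutation permutations_of_setD(2))

lemma order_iso_refl: "order_iso u u"
  by (simp add: order_iso_def)

lemma order_iso_sym: "order_iso u v \<Longrightarrow> order_iso v u"
  by (simp add: order_iso_def)

lemma order_iso_trans: "order_iso u v \<Longrightarrow> order_iso v w \<Longrightarrow> order_iso u w"
  by (simp add: order_iso_def)

lemma order_iso_map_add: "order_iso (map (\<lambda>a. a + k) u) u"
  by (simp add: order_iso_def)

lemma order_iso_take: "order_iso u v \<Longrightarrow> order_iso (take k u) (take k v)"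
  by (auto simp: order_iso_def)

lemma order_iso_drop: "order_iso u v \<Longrightarrow> order_iso (drop k u) (drop k v)"
  by (auto simp: order_iso_def)

text \<open>Pairs of positions lie in the first block, in the second, or across the border. Cross
  pairs are compared in both directions because \<open>order_iso\<close> ranges over ordered
  pairs.\<close>

lemma order_iso_append:
  assumes len: "length u = length u'"
  shows "order_iso (u @ v) (u' @ v') \<longleftrightarrow> order_iso u u' \<and> order_iso v v' \<and>
     (\<forall>i<length u'. \<forall>j<length v'.
        (u ! i < v ! j \<longleftrightarrow> u' ! i < v' ! j) \<and> (v ! j < u ! i \<longleftrightarrow> v' ! j < u' ! i))"
  (is "?L \<longleftrightarrow> ?R")
proof
  assume L: ?L
  hence lv: "length v = length v'" using order_iso_length[OF L] len by simp
  note cmp = order_iso_nth_less[OF L]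
  have "order_iso u u'" using order_iso_take[OF L, of "length u"] len by simp
  moreover have "order_iso v v'" using order_iso_drop[OF L, of "length u"] len by simp
  moreover have "(u ! i < v ! j \<longleftrightarrow> u' ! i < v' ! j) \<and> (v ! j < u ! i \<longleftrightarrow> v' ! j < u' ! i)"
    if "i < length u'" "j < length v'" for i j
    using cmp[of i "length u' + j"] cmp[of "length u' + j" i] that len lv
    by (simp add: nth_append)
  ultimately show ?R by blast
next
  assume R: ?R
  hence lv: "length v = length v'" by (simp add: order_iso_length)
  have "(u @ v) ! i < (u @ v) ! j \<longleftrightarrow> (u' @ v') ! i < (u' @ v') ! j"
    if "i < length (u @ v)" "j < length (u @ v)" for i j
    using R that len lv unfolding order_iso_def
    by (cases "i < length u"; cases "j < length u") (simp_all add: nth_append)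
  thus ?L using len lv by (simp add: order_iso_def)
qed

lemma order_iso_singleton: "order_iso [a] [b]"
  by (simp add: order_iso_def)

lemma order_iso_snoc:
  assumes "length u = length v"
  shows "order_iso (u @ [a]) (v @ [b]) \<longleftrightarrow> order_iso u v \<and>
     (\<forall>i<length v. (u ! i < a \<longleftrightarrow> v ! i < b) \<and> (a < u ! i \<longleftrightarrow> b < v ! i))"
  using assms by (simp add: order_iso_append order_iso_singleton)

lemma order_iso_Cons:
  "order_iso (a # u) (b # v) \<longleftrightarrow> order_iso u v \<and>
     (\<forall>i<length v. (a < u ! i \<longleftrightarrow> b < v ! i) \<and> (u ! i < a \<longleftrightarrow> v ! i < b))"
  using order_iso_append[of "[a]" "[b]" u v] by (simp add: order_iso_singleton)

text \<open>For \<sigma> shorter than \<open>p\<close> the truncated difference is 0, and the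
  unequal lengths make the predicate false.\<close>

definition suffix_iso :: "nat list \<Rightarrow> nat list \<Rightarrow> bool" where
  "suffix_iso p \<sigma> \<longleftrightarrow> order_iso (drop (length \<sigma> - length p) \<sigma>) p"

lemma suffix_iso_append:
  "length v = length p \<Longrightarrow> suffix_iso p (u @ v) \<longleftrightarrow> order_iso v p"
  by (simp add: suffix_iso_def)

lemma suffix_iso_append_long:
  "length p \<le> length v \<Longrightarrow> suffix_iso p (u @ v) \<longleftrightarrow> suffix_iso p v"
  by (simp add: suffix_iso_def)

lemma suffix_iso_length: "suffix_iso p \<sigma> \<Longrightarrow> length p \<le> length \<sigma>"
  by (auto simp: suffix_iso_def dest!: order_iso_length)

lemma suffix_iso_map_add: "suffix_iso p (map (\<lambda>a. a + k) \<sigma>) \<longleftrightarrow> suffix_iso p \<sigma>"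
  unfolding suffix_iso_def length_map drop_map
  using order_iso_map_add order_iso_sym order_iso_trans by blast

section \<open>Consecutive occurrences in a concatenation\<close>

lemma mch_append:
  "mch p (u @ v) = mch p u + mch p v +
     card {i. i < length u \<and> length u < i + length p \<and> i + length p \<le> length u + length v \<and>
              red (take (length p) (drop i (u @ v))) = p}" (is "_ = _ + _ + card ?C")
proof -
  define A where "A = {i. i < length u \<and> i + length p \<le> length u \<and>
                          red (take (length p) (drop i u)) = p}"
  define D where "D = {i. i < length v \<and> i + length p \<le> length v \<and>
                          red (take (length p) (drop i v)) = p}"
  have fin: "finite A" "finite D" "finite ?C"
    by (auto simp: A_def D_def)
  \<comment> \<open>Windows end within \<open>u\<close>, start in \<open>v\<close>, or cross the
    border; the three sets are disjoint, so cardinalities add.\<close>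
  have "{i. i < length (u @ v) \<and> i + length p \<le> length (u @ v) \<and>
            red (take (length p) (drop i (u @ v))) = p} = A \<union> (\<lambda>i. i + length u) ` D \<union> ?C"
    (is "?S = ?R")
  proof (intro equalityI subsetI)
    fix i assume i: "i \<in> ?S"
    show "i \<in> ?R"
    proof (cases "i < length u")
      case True
      thus ?thesis using i by (auto simp: A_def)
    next
      case False
      hence "i - length u \<in> D" using i by (auto simp: D_def)
      hence "(i - length u) + length u \<in> (\<lambda>i. i + length u) ` D" by blast
      thus ?thesis using False by simp
    qed
  next
    fix i assume "i \<in> ?R"
    thus "i \<in> ?S" by (auto simp: A_def D_def)
  qed
  hence "mch p (u @ v) = card (A \<union> (\<lambda>i. i + length u) ` D \<union> ?C)"
    by (simp add: mch_def)
  also have "\<dots> = card (A \<union> (\<lambda>i. i + length u) ` D) + card ?C"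
    using fin by (intro card_Un_disjoint) (auto simp: A_def D_def)
  also have "card (A \<union> (\<lambda>i. i + length u) ` D) = card A + card ((\<lambda>i. i + length u) ` D)"
    using fin by (intro card_Un_disjoint) (auto simp: A_def D_def)
  also have "card ((\<lambda>i. i + length u) ` D) = card D"
    by (intro card_image) (auto simp: inj_on_def)
  finally show ?thesis by (simp add: mch_def A_def D_def)
qed

lemma red_map_add: "red (map (\<lambda>a. a + k) w) = red w"
proof -
  have "{b \<in> (\<lambda>a. a + k) ` set w. b \<le> a + k} = (\<lambda>a. a + k) ` {b \<in> set w. b \<le> a}" for a
    by auto
  thus ?thesis
    by (auto simp: red_def card_image inj_on_def)
qed

lemma mch_map_add: "mch p (map (\<lambda>a. a + k) \<sigma>) = mch p \<sigma>"
  by (simp add: mch_def drop_map take_map red_map_add)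

lemma mch_short: "length \<sigma> < length p \<Longrightarrow> mch p \<sigma> = 0"
  by (auto simp: mch_def)

lemma avoids_132_iff:
  assumes "distinct \<sigma>"
  shows "avoids \<sigma> [1, 3, 2] \<longleftrightarrow> (\<forall>a b c. subseq [a, c, b] \<sigma> \<longrightarrow> \<not> (a < b \<and> b < c))"
proof -
  have p: "[1, 3, 2] \<in> permutations_of_set {1..3::nat}"
    by (auto simp: permutations_of_set_def)
  have iso: "red w = [1, 3, 2] \<longleftrightarrow> (\<exists>a b c. w = [a, c, b] \<and> a < b \<and> b < c)"
    if "subseq w \<sigma>" for w
  proof -
    have "distinct w" using that assms by (metis subseq_conv_nths distinct_nthsI)
    hence "red w = [1, 3, 2] \<longleftrightarrow> order_iso w [1, 3, 2]"
      by (rule red_eq_iff_order_iso[OF _ p])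
    also have "\<dots> \<longleftrightarrow> (\<exists>a c b. w = [a, c, b] \<and> order_iso [a, c, b] [1, 3, 2])"
      using order_iso_length[of w "[1, 3, 2]"] by (auto simp: length_Suc_conv)
    also have "\<dots> \<longleftrightarrow> (\<exists>a b c. w = [a, c, b] \<and> a < b \<and> b < c)"
      by (auto simp: order_iso_Cons order_iso_refl All_less_Suc2)
    finally show ?thesis .
  qed
  show ?thesis unfolding avoids_def using iso by (metis (no_types))
qed

subsection \<open>132-avoiding permutations\<close>

text \<open>Inequality form of avoidance, also meaningful for shifted words and factors that are not
  permutations of an initial interval.\<close>

definition no_132 :: "nat list \<Rightarrow> bool" where
  "no_132 \<sigma> \<longleftrightarrow> (\<forall>a b c. subseq [a, c, b] \<sigma> \<longrightarrow> \<not> (a < b \<and> b < c))"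

text \<open>The border can fall after three, two, one or none of the three letters.\<close>

lemma subseq_three_append_iff:
  "subseq [a, c, b] (u @ v) \<longleftrightarrow> subseq [a, c, b] u \<or> subseq [a, c] u \<and> b \<in> set v \<or>
     a \<in> set u \<and> subseq [c, b] v \<or> subseq [a, c, b] v" (is "?L \<longleftrightarrow> ?R")
proof
  assume ?L
  thus ?R
    by (auto simp: subseq_append_iff Cons_eq_append_conv subseq_singleton_left)
next
  have "subseq (xs @ ys) (u @ v)" if "subseq xs u" "subseq ys v" for xs ys
    using that by (rule list_emb_append_mono)
  from this[of "[a, c, b]" "[]"] this[of "[a, c]" "[b]"] this[of "[a]" "[c, b]"]
    this[of "[]" "[a, c, b]"]
  show "?R \<Longrightarrow> ?L"
    by (auto simp: subseq_singleton_left)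
qed

lemma subseq_set_subset: "subseq u v \<Longrightarrow> set u \<subseteq> set v"
  by (metis subseq_conv_nths set_nths_subset)

lemma no_132_subseq: "no_132 \<sigma> \<Longrightarrow> subseq \<tau> \<sigma> \<Longrightarrow> no_132 \<tau>"
  unfolding no_132_def by (meson subseq_order.trans)

lemma no_132_appendD: "no_132 (u @ v) \<Longrightarrow> no_132 u" "no_132 (u @ v) \<Longrightarrow> no_132 v"
  by (auto elim!: no_132_subseq)

lemma no_132_map_add: "no_132 (map (\<lambda>a. a + k) \<sigma>) \<longleftrightarrow> no_132 \<sigma>"
proof
  assume L: "no_132 (map (\<lambda>a. a + k) \<sigma>)"
  show "no_132 \<sigma>"
    unfolding no_132_def
  proof (intro allI impI)
    fix a b c assume "subseq [a, c, b] \<sigma>"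
    hence "subseq (map (\<lambda>a. a + k) [a, c, b]) (map (\<lambda>a. a + k) \<sigma>)"
      by (rule subseq_map)
    thus "\<not> (a < b \<and> b < c)" using L unfolding no_132_def by fastforce
  qed
next
  assume R: "no_132 \<sigma>"
  show "no_132 (map (\<lambda>a. a + k) \<sigma>)"
    unfolding no_132_def
  proof (intro allI impI)
    fix a b c assume "subseq [a, c, b] (map (\<lambda>a. a + k) \<sigma>)"
    then obtain N where "[a, c, b] = map (\<lambda>a. a + k) (nths \<sigma> N)"
      by (metis subseq_conv_nths nths_map)
    then obtain a' b' c' where "nths \<sigma> N = [a', c', b']"
        and eq: "a = a' + k" "b = b' + k" "c = c' + k"
      by (auto simp: Cons_eq_map_conv)
    hence "subseq [a', c', b'] \<sigma>" by (metis subseq_conv_nths)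
    thus "\<not> (a < b \<and> b < c)" using R eq unfolding no_132_def by fastforce
  qed
qed

text \<open>In a new occurrence the appended letter would come last and thus have the middle value,
  but it exceeds every other letter.\<close>

lemma no_132_snoc:
  assumes "\<And>a. a \<in> set u \<Longrightarrow> a < c"
  shows "no_132 (u @ [c]) \<longleftrightarrow> no_132 u"
proof -
  have "\<not> (a < b \<and> b < d)" if "subseq [a, d] u \<and> b = c" for a b d
    using subseq_set_subset[of "[a, d]" u] assms that by fastforce
  moreover have "\<not> subseq [d, b] [c]" "\<not> subseq [a, d, b] [c]" for a b d
    by (auto dest: list_emb_length)
  ultimately show ?thesis
    unfolding no_132_def subseq_three_append_iff by (metis empty_set list.simps(15) singletonD)
qed

text \<open>An occurrence crossing the border would start in \<open>u\<close> and end in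
  \<open>v\<close>, yet the last letter of a 132 exceeds its first.\<close>

lemma no_132_append_decreasing:
  assumes "\<And>a b. a \<in> set u \<Longrightarrow> b \<in> set v \<Longrightarrow> b < a"
  shows "no_132 (u @ v) \<longleftrightarrow> no_132 u \<and> no_132 v"
proof -
  have "\<not> (a < b \<and> b < c)" if "subseq [a, c] u \<and> b \<in> set v" for a b c
    using subseq_set_subset[of "[a, c]" u] assms that by fastforce
  moreover have "\<not> (a < b \<and> b < c)" if "a \<in> set u \<and> subseq [c, b] v" for a b c
    using subseq_set_subset[of "[c, b]" v] assms that by fastforce
  ultimately show ?thesis
    unfolding no_132_def subseq_three_append_iff by blast
qed

definition Av :: "nat \<Rightarrow> nat list set" where
  "Av n = avoiding_perms n [1, 3, 2]"

lemma mem_Av_iff: "\<sigma> \<in> Av n \<longleftrightarrow> set \<sigma> = {1..n} \<and> distinct \<sigma> \<and> no_132 \<sigma>"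
  unfolding Av_def avoiding_perms_def permutations_of_set_def no_132_def
  using avoids_132_iff by auto

lemma length_Av: "\<sigma> \<in> Av n \<Longrightarrow> length \<sigma> = n"
  using distinct_card[of \<sigma>] by (simp add: mem_Av_iff)

lemma finite_Av: "finite (Av n)"
  by (simp add: Av_def avoiding_perms_def)

lemma Av_0: "Av 0 = {[]}"
  by (auto simp: mem_Av_iff no_132_def)

lemma Av_snoc: "u @ [Suc k] \<in> Av (Suc k) \<longleftrightarrow> u \<in> Av k"
proof
  assume "u @ [Suc k] \<in> Av (Suc k)"
  hence u: "insert (Suc k) (set u) = {1..Suc k}" "Suc k \<notin> set u" "distinct u" "no_132 u"
    by (auto simp: mem_Av_iff dest: no_132_appendD)
  have "set u = {1..Suc k} - {Suc k}" using u(1,2) by blast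
  also have "\<dots> = {1..k}" by auto
  finally show "u \<in> Av k" using u(3,4) by (simp add: mem_Av_iff)
next
  assume "u \<in> Av k"
  moreover from this have "no_132 (u @ [Suc k])"
    by (subst no_132_snoc) (auto simp: mem_Av_iff)
  ultimately show "u @ [Suc k] \<in> Av (Suc k)"
    by (auto simp: mem_Av_iff)
qed

section \<open>Skew sums and the decomposition around the maximum\<close>

definition skew :: "nat list \<Rightarrow> nat list \<Rightarrow> nat list" where
  "skew u v = map (\<lambda>a. a + length v) u @ v"

lemma skew_Av:
  assumes "u \<in> Av k" "v \<in> Av l"
  shows "skew u v \<in> Av (k + l)"
proof -
  have l: "length v = l" using assms length_Av by blast
  have "no_132 (skew u v)"
    unfolding skew_def
    by (subst no_132_append_decreasing) (use assms l in \<open>auto simp: mem_Av_iff no_132_map_add\<close>)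
  moreover have "set (skew u v) = {1..k + l}"
  proof -
    have "(\<lambda>a. a + l) ` {1..k} = {1 + l..k + l}" by simp
    thus ?thesis using assms l by (auto simp: skew_def mem_Av_iff)
  qed
  moreover have "distinct (skew u v)"
    using assms l by (auto simp: skew_def mem_Av_iff distinct_map inj_on_def)
  ultimately show ?thesis by (simp add: mem_Av_iff)
qed

lemma downward_closed_eq_interval:
  assumes "finite A" "0 \<notin> A" "\<And>a b. a \<in> A \<Longrightarrow> 1 \<le> b \<Longrightarrow> b \<le> a \<Longrightarrow> b \<in> A"
  shows "A = {1..card A :: nat}"
proof (cases "A = {}")
  case False
  hence "A = {1..Max A}"
    using assms(2) assms(3)[OF Max_in[OF assms(1) False]] Max_ge[OF assms(1)]
    by (auto simp: Suc_le_eq intro: gr0I)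
  thus ?thesis by (metis card_atLeastAtMost diff_Suc_1 One_nat_def)
qed simp

text \<open>Inverts \<open>skew\<close>: no value below a letter of \<open>v\<close> can occur in
  \<open>u\<close>, so \<open>v\<close> fills an initial interval, and lowering \<open>u\<close> by
  \<open>length v\<close> makes it a permutation.\<close>

lemma Av_append_decreasing:
  assumes uv: "u @ v \<in> Av n" and gt: "\<And>a b. a \<in> set u \<Longrightarrow> b \<in> set v \<Longrightarrow> b < a"
  obtains u' where "u' \<in> Av (length u)" "v \<in> Av (length v)" "u = map (\<lambda>a. a + length v) u'"
    "u @ v = skew u' v"
proof -
  have set: "set u \<union> set v = {1..n}" and d: "distinct u" "distinct v" "set u \<inter> set v = {}"
    and no: "no_132 u" "no_132 v"
    using uv by (auto simp: mem_Av_iff dest: no_132_appendD)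
  have n: "n = length u + length v" using length_Av[OF uv] by simp
  have "set v = {1..card (set v)}"
  proof (rule downward_closed_eq_interval)
    show "0 \<notin> set v" using set by fastforce
    fix a b assume "a \<in> set v" "1 \<le> b" "b \<le> a"
    moreover from this have "b \<in> set u \<union> set v"
      using set by (metis UnI2 atLeastAtMost_iff order.trans)
    ultimately show "b \<in> set v" using gt[of b a] by auto
  qed simp
  hence v: "set v = {1..length v}" using d by (simp add: distinct_card)
  have su: "set u = {1..n} - {1..length v}" using set d v by blast
  define u' where "u' = map (\<lambda>a. a - length v) u"
  have u: "u = map (\<lambda>a. a + length v) u'"
    unfolding u'_def map_map by (rule map_idI[symmetric]) (auto simp: su)
  have "distinct u'" using d(1) unfolding u by (simp add: distinct_map)
  moreover have "no_132 u'" using no(1) unfolding u by (simp add: no_132_map_add)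
  moreover have "set u' = {1..length u}"
  proof -
    have "(\<lambda>a. a + length v) ` set u' = (\<lambda>a. a + length v) ` {1..length u}"
      using su n unfolding u by auto
    thus ?thesis by (subst (asm) inj_image_eq_iff) (auto simp: inj_on_def)
  qed
  ultimately have "u' \<in> Av (length u)" by (simp add: mem_Av_iff)
  moreover have "v \<in> Av (length v)" using v d no by (simp add: mem_Av_iff)
  moreover have "u @ v = skew u' v" unfolding skew_def using u by simp
  ultimately show thesis using that u by blast
qed

text \<open>Rebuilds a nonempty avoider from the parts before and after its maximum. Going through
  \<open>skew\<close> reuses the closure of \<open>Av\<close> under skew sums and its
  inverse.\<close>

definition glue :: "nat list \<Rightarrow> nat list \<Rightarrow> nat list" where
  "glue \<alpha> \<beta> = skew (\<alpha> @ [Suc (length \<alpha>)]) \<beta>"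

lemma glue_conv:
  "glue \<alpha> \<beta> = map (\<lambda>a. a + length \<beta>) \<alpha> @ Suc (length \<alpha> + length \<beta>) # \<beta>"
  by (simp add: glue_def skew_def)

lemma glue_Av: "\<alpha> \<in> Av k \<Longrightarrow> \<beta> \<in> Av l \<Longrightarrow> glue \<alpha> \<beta> \<in> Av (Suc (k + l))"
  using skew_Av[of "\<alpha> @ [Suc k]" "Suc k" \<beta> l] by (simp add: glue_def Av_snoc length_Av)

lemma Av_Suc_obtain:
  assumes \<sigma>: "\<sigma> \<in> Av (Suc n)"
  obtains k \<alpha> \<beta> where "k \<le> n" "\<alpha> \<in> Av k" "\<beta> \<in> Av (n - k)" "\<sigma> = glue \<alpha> \<beta>"
proof -
  have "Suc n \<in> set \<sigma>" using \<sigma> by (simp add: mem_Av_iff)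
  then obtain u v where uv: "\<sigma> = u @ Suc n # v" by (meson split_list)
  have mem: "set \<sigma> = {1..Suc n}" "distinct \<sigma>" "no_132 \<sigma>" using \<sigma> by (simp_all add: mem_Av_iff)
  \<comment> \<open>A letter before the maximum that lies below a letter after it would form a 132
    with the maximum as its 3.\<close>
  have gt: "b < a" if a: "a \<in> set (u @ [Suc n])" and b: "b \<in> set v" for a b
  proof -
    have "b \<in> set \<sigma>" "b \<noteq> Suc n" "a \<noteq> b" using a b mem(2) unfolding uv by auto
    hence bn: "b < Suc n" "a \<noteq> b" using mem(1) by auto
    show ?thesis
    proof (cases "a = Suc n")
      case False
      hence "subseq ([a] @ [Suc n] @ [b]) (u @ [Suc n] @ v)"
        using a b by (intro list_emb_append_mono) (auto simp: subseq_singleton_left)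
      hence "subseq [a, Suc n, b] \<sigma>" by (simp add: uv)
      hence "\<not> (a < b \<and> b < Suc n)" using mem(3) unfolding no_132_def by blast
      thus ?thesis using bn by auto
    qed (use bn in simp)
  qed
  have "(u @ [Suc n]) @ v \<in> Av (Suc n)" using \<sigma> uv by simp
  then obtain w where w: "w \<in> Av (length (u @ [Suc n]))" "v \<in> Av (length v)"
      "u @ [Suc n] = map (\<lambda>a. a + length v) w" "(u @ [Suc n]) @ v = skew w v"
    using gt by (rule Av_append_decreasing)
  have n: "n = length u + length v" using length_Av[OF \<sigma>] uv by simp
  from w(3) obtain \<alpha> c where \<alpha>: "w = \<alpha> @ [c]" "u = map (\<lambda>a. a + length v) \<alpha>" "Suc n = c + length v"
    by (auto simp: append_eq_map_conv)
  hence c: "c = Suc (length \<alpha>)" using n by simp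
  have "\<alpha> \<in> Av (length u)" using w(1) \<alpha> c by (simp add: Av_snoc)
  moreover have "\<sigma> = glue \<alpha> v" using w(4) uv \<alpha> c by (simp add: glue_def)
  ultimately show thesis using that[of "length u" \<alpha> v] w(2) n by simp
qed

text \<open>Both words have the same maximum \<open>Suc n\<close>, and by distinctness it occurs
  once, so its position fixes the cut.\<close>

lemma glue_inject:
  assumes "\<alpha> \<in> Av k" "\<beta> \<in> Av (n - k)" "\<alpha>' \<in> Av k'" "\<beta>' \<in> Av (n - k')" "k \<le> n" "k' \<le> n"
    and eq: "glue \<alpha> \<beta> = glue \<alpha>' \<beta>'"
  shows "\<alpha> = \<alpha>' \<and> \<beta> = \<beta>'"
proof -
  have len: "length \<alpha> + length \<beta> = n" "length \<alpha>' + length \<beta>' = n"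
    using assms length_Av by fastforce+
  have "distinct (glue \<alpha> \<beta>)"
    using glue_Av[OF assms(1,2)] by (simp add: mem_Av_iff)
  hence "Suc n \<notin> set (map (\<lambda>a. a + length \<beta>) \<alpha>)" "Suc n \<notin> set \<beta>"
    by (auto simp: glue_conv len)
  hence "map (\<lambda>a. a + length \<beta>) \<alpha> = map (\<lambda>a. a + length \<beta>') \<alpha>'" "\<beta> = \<beta>'"
    using eq by (auto simp: glue_conv len append_Cons_eq_iff)
  thus ?thesis by (auto simp: inj_on_def dest!: map_injective)
qed

lemma sum_Av_Suc:
  fixes w :: "nat list \<Rightarrow> 'a :: comm_monoid_add"
  shows "(\<Sum>\<sigma>\<in>Av (Suc n). w \<sigma>) = (\<Sum>k\<le>n. \<Sum>\<alpha>\<in>Av k. \<Sum>\<beta>\<in>Av (n - k). w (glue \<alpha> \<beta>))"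
proof -
  let ?S = "SIGMA k:{..n}. Av k \<times> Av (n - k)"
  have "bij_betw (\<lambda>(k, \<alpha>, \<beta>). glue \<alpha> \<beta>) ?S (Av (Suc n))"
    unfolding bij_betw_def
  proof
    have "k = k' \<and> \<alpha> = \<alpha>' \<and> \<beta> = \<beta>'"
      if "k \<le> n" "\<alpha> \<in> Av k" "\<beta> \<in> Av (n - k)" "k' \<le> n" "\<alpha>' \<in> Av k'" "\<beta>' \<in> Av (n - k')"
        "glue \<alpha> \<beta> = glue \<alpha>' \<beta>'" for k \<alpha> \<beta> k' \<alpha>' \<beta>'
      using glue_inject[OF that(2,3,5,6,1,4,7)] length_Av that(2,5) by blast
    thus "inj_on (\<lambda>(k, \<alpha>, \<beta>). glue \<alpha> \<beta>) ?S"
      unfolding inj_on_def by (auto simp del: One_nat_def)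
    show "(\<lambda>(k, \<alpha>, \<beta>). glue \<alpha> \<beta>) ` ?S = Av (Suc n)"
    proof (intro equalityI subsetI)
      fix \<sigma> assume "\<sigma> \<in> (\<lambda>(k, \<alpha>, \<beta>). glue \<alpha> \<beta>) ` ?S"
      then obtain k \<alpha> \<beta> where "k \<le> n" "\<alpha> \<in> Av k" "\<beta> \<in> Av (n - k)" "\<sigma> = glue \<alpha> \<beta>" by auto
      thus "\<sigma> \<in> Av (Suc n)" using glue_Av[of \<alpha> k \<beta> "n - k"] by simp
    next
      fix \<sigma> assume "\<sigma> \<in> Av (Suc n)"
      then obtain k \<alpha> \<beta> where "k \<le> n" "\<alpha> \<in> Av k" "\<beta> \<in> Av (n - k)" "\<sigma> = glue \<alpha> \<beta>"
        by (rule Av_Suc_obtain)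
      thus "\<sigma> \<in> (\<lambda>(k, \<alpha>, \<beta>). glue \<alpha> \<beta>) ` ?S" by (intro image_eqI[of _ _ "(k, \<alpha>, \<beta>)"]) auto
    qed
  qed
  hence "(\<Sum>\<sigma>\<in>Av (Suc n). w \<sigma>) = (\<Sum>(k, \<alpha>, \<beta>)\<in>?S. w (glue \<alpha> \<beta>))"
    by (simp add: sum.reindex_bij_betw[symmetric] case_prod_unfold)
  also have "\<dots> = (\<Sum>k\<le>n. \<Sum>(\<alpha>, \<beta>)\<in>Av k \<times> Av (n - k). w (glue \<alpha> \<beta>))"
    by (subst sum.Sigma) (auto simp: finite_Av)
  also have "\<dots> = (\<Sum>k\<le>n. \<Sum>\<alpha>\<in>Av k. \<Sum>\<beta>\<in>Av (n - k). w (glue \<alpha> \<beta>))"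
    by (simp add: sum.cartesian_product)
  finally show ?thesis .
qed

section \<open>Weighted generating functions of 132-avoiders\<close>

definition Av_gf :: "(nat list \<Rightarrow> int poly) \<Rightarrow> int poly fps" where
  "Av_gf w = Abs_fps (\<lambda>n. \<Sum>\<sigma>\<in>Av n. w \<sigma>)"

lemma Av_gf_mult_nth:
  "fps_nth (Av_gf f * Av_gf g) n = (\<Sum>k\<le>n. \<Sum>\<alpha>\<in>Av k. \<Sum>\<beta>\<in>Av (n - k). f \<alpha> * g \<beta>)"
  by (simp add: Av_gf_def fps_mult_nth sum_product atLeast0AtMost)

lemma Av_gf_add: "Av_gf (\<lambda>\<sigma>. f \<sigma> + g \<sigma>) = Av_gf f + Av_gf g"
  by (simp add: Av_gf_def fps_eq_iff sum.distrib)

lemma Av_gf_cmult: "Av_gf (\<lambda>\<sigma>. c * f \<sigma>) = fps_const c * Av_gf f"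
  by (simp add: Av_gf_def fps_eq_iff sum_distrib_left)

lemma Av_gf_Nil: "Av_gf (\<lambda>\<sigma>. if \<sigma> = [] then c else 0) = fps_const c"
proof -
  have "(\<Sum>\<sigma>\<in>Av n. if \<sigma> = [] then c else 0) = (if n = 0 then c else 0)" for n
  proof (cases "n = 0")
    case True
    thus ?thesis by (simp add: Av_0)
  next
    case False
    hence "\<sigma> \<noteq> []" if "\<sigma> \<in> Av n" for \<sigma> using that length_Av by fastforce
    thus ?thesis using False by (intro sum.neutral[THEN trans]) auto
  qed
  thus ?thesis by (simp add: Av_gf_def fps_eq_iff)
qed

text \<open>Products of weights summed over all splittings become products of series; the factor
  \<open>fps_X\<close> marks the maximum and the constant term the empty word. Three products cover
  both weights treated below.\<close>

lemma Av_gf_glue: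
  assumes "\<And>\<alpha> \<beta> k l. \<alpha> \<in> Av k \<Longrightarrow> \<beta> \<in> Av l \<Longrightarrow>
             w (glue \<alpha> \<beta>) = f1 \<alpha> * g1 \<beta> + f2 \<alpha> * g2 \<beta> + f3 \<alpha> * g3 \<beta>"
  shows "Av_gf w = fps_const (w []) +
           fps_X * (Av_gf f1 * Av_gf g1 + Av_gf f2 * Av_gf g2 + Av_gf f3 * Av_gf g3)"
proof (rule fps_ext)
  fix n
  show "fps_nth (Av_gf w) n = fps_nth (fps_const (w []) +
           fps_X * (Av_gf f1 * Av_gf g1 + Av_gf f2 * Av_gf g2 + Av_gf f3 * Av_gf g3)) n"
  proof (cases n)
    case 0
    thus ?thesis by (simp add: Av_gf_def Av_0)
  next
    case (Suc j)
    have "fps_nth (Av_gf w) n = (\<Sum>k\<le>j. \<Sum>\<alpha>\<in>Av k. \<Sum>\<beta>\<in>Av (j - k).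
            f1 \<alpha> * g1 \<beta> + f2 \<alpha> * g2 \<beta> + f3 \<alpha> * g3 \<beta>)"
      by (simp add: Suc Av_gf_def sum_Av_Suc assms cong: sum.cong)
    thus ?thesis by (simp add: Suc Av_gf_mult_nth sum.distrib)
  qed
qed

subsection \<open>Occurrences of the pattern and the functional equation\<close>

text \<open>Here \<open>k = m - 3\<close>, and \<tau> consists of the letters of \<gamma> strictly
  between the first and the second to last, lowered by one. Requiring \<open>0 < k\<close> rules out
  the pattern 231.\<close>

locale pattern_132 =
  fixes k :: nat and \<tau> :: "nat list"
  assumes k: "0 < k" and \<tau>: "\<tau> \<in> Av k"
begin

text \<open>The prefixes keep the letters they have in \<gamma> rather than being reduced; they are
  compared with other words only through \<open>order_iso\<close>.\<close>

definition p1 :: "nat list" where "p1 = (k + 2) # map Suc \<tau>"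
definition p2 :: "nat list" where "p2 = p1 @ [k + 3]"
definition \<gamma> :: "nat list" where "\<gamma> = p2 @ [1]"

lemma length_\<tau>: "length \<tau> = k"
  using \<tau> by (rule length_Av)

lemma length_p [simp]: "length p1 = k + 1" "length p2 = k + 2" "length \<gamma> = k + 3"
  by (simp_all add: p1_def p2_def \<gamma>_def length_\<tau>)

lemma set_p1: "set p1 = {2..k + 2}"
proof -
  have "set p1 = insert (k + 2) (Suc ` {1..k})"
    using \<tau> by (simp add: p1_def mem_Av_iff)
  also have "Suc ` {1..k} = {2..k + 1}" by (simp add: numeral_2_eq_2)
  also have "insert (k + 2) {2..k + 1} = {2..k + 2}"
    unfolding set_eq_iff insert_iff atLeastAtMost_iff by arith
  finally show ?thesis .
qed

lemma \<gamma>_permutation: "\<gamma> \<in> permutations_of_set {1..k + 3}"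
proof -
  have "distinct p1"
    using \<tau> by (auto simp: p1_def mem_Av_iff distinct_map)
  hence "distinct \<gamma>" by (auto simp: \<gamma>_def p2_def set_p1)
  moreover have "set \<gamma> = {1..k + 3}"
    unfolding \<gamma>_def p2_def set_append set_p1 set_eq_iff Un_iff list.set insert_iff atLeastAtMost_iff
      empty_iff
    by arith
  ultimately show ?thesis by (simp add: permutations_of_set_def)
qed

lemma red_eq_\<gamma>_iff: "distinct w \<Longrightarrow> red w = \<gamma> \<longleftrightarrow> order_iso w \<gamma>"
  using \<gamma>_permutation by (rule red_eq_iff_order_iso[rotated])

lemma p1_nth: "i < k + 1 \<Longrightarrow> 1 < p1 ! i \<and> p1 ! i < k + 3"
  using nth_mem[of i p1] set_p1 by auto

lemma p2_nth: "i < k + 2 \<Longrightarrow> 1 < p2 ! i" "i < k + 1 \<Longrightarrow> p2 ! i < k + 3" "p2 ! (k + 1) = k + 3"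
  using p1_nth[of i] by (auto simp: p2_def nth_append less_Suc_eq)

text \<open>The window arguments rest on these entries: the maximum sits at 0-based position
  \<open>k + 1\<close>, second to last, and exceeds the first letter.\<close>

lemma \<gamma>_nth: "\<gamma> ! 0 = k + 2" "\<gamma> ! (k + 1) = k + 3" "i < k + 3 \<Longrightarrow> i \<noteq> k + 1 \<Longrightarrow> \<gamma> ! i < k + 3"
proof -
  show "\<gamma> ! 0 = k + 2" by (simp add: \<gamma>_def p2_def p1_def)
  show "\<gamma> ! (k + 1) = k + 3"
    unfolding \<gamma>_def using p2_nth(3) by (simp add: nth_append)
  assume "i < k + 3" "i \<noteq> k + 1"
  hence "i < k + 1 \<or> i = k + 2" by auto
  thus "\<gamma> ! i < k + 3"
    unfolding \<gamma>_def using p2_nth(2)[of i] by (auto simp: nth_append)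
qed

section \<open>Occurrences crossing the maximum or the border of a skew sum\<close>

lemma order_iso_p2_snoc:
  assumes "length w = k + 1" "\<And>a. a \<in> set w \<Longrightarrow> a < c"
  shows "order_iso (w @ [c]) p2 \<longleftrightarrow> order_iso w p1"
proof -
  have "(w ! i < c \<longleftrightarrow> p1 ! i < k + 3) \<and> (c < w ! i \<longleftrightarrow> k + 3 < p1 ! i)" if "i < length p1" for i
    using assms(1) assms(2)[of "w ! i"] p1_nth[of i] that by fastforce
  thus ?thesis unfolding p2_def by (subst order_iso_snoc) (use assms(1) in auto)
qed

lemma order_iso_\<gamma>_snoc:
  assumes "length w = k + 2" "\<And>a. a \<in> set w \<Longrightarrow> d < a"
  shows "order_iso (w @ [d]) \<gamma> \<longleftrightarrow> order_iso w p2"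
proof -
  have "(w ! i < d \<longleftrightarrow> p2 ! i < 1) \<and> (d < w ! i \<longleftrightarrow> 1 < p2 ! i)" if "i < length p2" for i
    using assms(1) assms(2)[of "w ! i"] p2_nth(1)[of i] that by fastforce
  thus ?thesis unfolding \<gamma>_def by (subst order_iso_snoc) (use assms(1) in auto)
qed

text \<open>A straddling window contains \<open>N\<close>, its largest letter, which must sit where
  \<gamma> has its maximum. This fixes the start and leaves exactly one letter of \<beta> at the
  end.\<close>

lemma straddling_glue:
  assumes d: "distinct (u @ N # \<beta>)"
    and u: "\<And>a. a \<in> set u \<Longrightarrow> a < N" and \<beta>: "\<And>a b. a \<in> set (N # u) \<Longrightarrow> b \<in> set \<beta> \<Longrightarrow> b < a"
  shows "i < length u \<and> length u < i + length \<gamma> \<and> i + length \<gamma> \<le> length u + length (N # \<beta>) \<and>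
           red (take (length \<gamma>) (drop i (u @ N # \<beta>))) = \<gamma> \<longleftrightarrow>
         i + (k + 1) = length u \<and> \<beta> \<noteq> [] \<and> suffix_iso p1 u" (is "?L \<longleftrightarrow> ?R")
proof -
  define w where "w = take (k + 3) (drop i (u @ N # \<beta>))"
  have "distinct w" using d by (simp add: w_def distinct_take distinct_drop del: drop_append take_append)
  hence red: "red w = \<gamma> \<longleftrightarrow> order_iso w \<gamma>" by (rule red_eq_\<gamma>_iff)
  have main: "order_iso w \<gamma> \<longleftrightarrow> suffix_iso p1 u" if i: "i + (k + 1) = length u" and "\<beta> \<noteq> []"
  proof -
    obtain b \<beta>' where b: "\<beta> = b # \<beta>'" using \<open>\<beta> \<noteq> []\<close> by (cases \<beta>) auto
    have len: "length (drop i u) = k + 1" using i by simp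
    have w: "w = (drop i u @ [N]) @ [b]" using i len by (simp add: w_def b)
    \<comment> \<open>Peel off the last letter, a minimum, then \<open>N\<close>, a maximum; the
      last \<open>k + 1\<close> letters of \<open>u\<close> remain.\<close>
    have "order_iso w \<gamma> \<longleftrightarrow> order_iso (drop i u @ [N]) p2"
      unfolding w using i \<beta>[of _ b] by (intro order_iso_\<gamma>_snoc) (auto simp: b dest: in_set_dropD)
    also have "\<dots> \<longleftrightarrow> order_iso (drop i u) p1"
      using len u by (intro order_iso_p2_snoc) (auto dest: in_set_dropD)
    also have "\<dots> \<longleftrightarrow> suffix_iso p1 u"
      unfolding suffix_iso_def length_p using i by (simp flip: i)
    finally show ?thesis .
  qed
  show ?thesis
  proof
    assume L: ?L
    hence iso: "order_iso w \<gamma>" using red unfolding w_def length_p by blast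
    hence lw: "length w = k + 3" by (auto dest: order_iso_length)
    \<comment> \<open>\<open>q\<close> is the position of \<open>N\<close> inside the
      window.\<close>
    define q where "q = length u - i"
    have q: "q < k + 3" "q + i = length u" using L by (auto simp: q_def)
    have "w ! q = (u @ N # \<beta>) ! (i + q)"
      unfolding w_def using q L by (simp del: drop_append take_append)
    hence wq: "w ! q = N" using q by (simp add: add.commute)
    have "q = k + 1"
    proof (rule ccontr)
      assume "q \<noteq> k + 1"
      hence "\<gamma> ! q < \<gamma> ! (k + 1)" using \<gamma>_nth q by simp
      hence "N < w ! (k + 1)" using order_iso_nth_less[OF iso, of q "k + 1"] q wq by simp
      moreover have "w ! (k + 1) \<in> set w" using lw by (intro nth_mem) simp
      hence "w ! (k + 1) \<in> set (u @ N # \<beta>)"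
        unfolding w_def by (metis in_set_takeD in_set_dropD)
      hence "w ! (k + 1) \<le> N"
        using u[of "w ! (k + 1)"] \<beta>[of N "w ! (k + 1)"] by auto
      ultimately show False by simp
    qed
    moreover have "\<beta> \<noteq> []" using L q \<open>q = k + 1\<close> by auto
    ultimately show ?R using main iso q by simp
  next
    assume R: ?R
    hence "length \<beta> \<ge> 1" by (cases \<beta>) auto
    thus ?L unfolding length_p w_def[symmetric] using R main red by auto
  qed
qed

lemma card_Collect_eq_conj: "card {i. i + c = (l::nat) \<and> Q} = (if Q \<and> c \<le> l then 1 else 0)"
proof -
  have "{i. i + c = l \<and> Q} = (if Q \<and> c \<le> l then {l - c} else {})" by auto
  thus ?thesis by simp
qed

lemma glue_properties:
  assumes "\<alpha> \<in> Av a" "\<beta> \<in> Av b"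
  shows "distinct (glue \<alpha> \<beta>)"
    "\<And>z. z \<in> set (map (\<lambda>a. a + length \<beta>) \<alpha>) \<Longrightarrow> z < Suc (length \<alpha> + length \<beta>)"
    "\<And>y z. y \<in> set (Suc (length \<alpha> + length \<beta>) # map (\<lambda>a. a + length \<beta>) \<alpha>) \<Longrightarrow> z \<in> set \<beta> \<Longrightarrow> z < y"
  using glue_Av[OF assms] assms length_Av[OF assms(1)] length_Av[OF assms(2)]
  by (auto simp: mem_Av_iff)

lemma mch_glue:
  assumes "\<alpha> \<in> Av a" "\<beta> \<in> Av b"
  shows "mch \<gamma> (glue \<alpha> \<beta>) =
           mch \<gamma> \<alpha> + mch \<gamma> \<beta> + (if suffix_iso p1 \<alpha> \<and> \<beta> \<noteq> [] then 1 else 0)"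
proof -
  define u where "u = map (\<lambda>a. a + length \<beta>) \<alpha>"
  define N where "N = Suc (length \<alpha> + length \<beta>)"
  have g: "glue \<alpha> \<beta> = u @ N # \<beta>" by (simp add: u_def N_def glue_conv)
  note props = glue_properties[OF assms, folded u_def N_def, unfolded g]
  have "mch \<gamma> (u @ N # \<beta>) = mch \<gamma> u + mch \<gamma> (N # \<beta>) +
          card {i. i + (k + 1) = length u \<and> \<beta> \<noteq> [] \<and> suffix_iso p1 u}"
    unfolding mch_append
    by (intro arg_cong2[where f = "(+)"] arg_cong[where f = card] Collect_cong straddling_glue refl)
       (use props in auto)
  also have "card {i. i + (k + 1) = length u \<and> \<beta> \<noteq> [] \<and> suffix_iso p1 u} =
      (if suffix_iso p1 \<alpha> \<and> \<beta> \<noteq> [] then 1 else 0)"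
    using suffix_iso_length[of p1 \<alpha>]
    unfolding card_Collect_eq_conj u_def suffix_iso_map_add by auto
  also have "mch \<gamma> (N # \<beta>) = mch \<gamma> \<beta>"
  proof -
    \<comment> \<open>A match starting at \<open>N\<close> would begin with its largest letter,
      whereas \<gamma> has a later letter above its first.\<close>
    have "\<not> (i < length [N] \<and> length [N] < i + length \<gamma> \<and> i + length \<gamma> \<le> length [N] + length \<beta> \<and>
              red (take (length \<gamma>) (drop i ([N] @ \<beta>))) = \<gamma>)" for i
    proof
      assume L: "i < length [N] \<and> length [N] < i + length \<gamma> \<and> i + length \<gamma> \<le> length [N] + length \<beta> \<and>
              red (take (length \<gamma>) (drop i ([N] @ \<beta>))) = \<gamma>"
      define w where "w = take (k + 3) (N # \<beta>)"
      have "distinct w" using props(1) by (simp add: w_def del: take_Cons)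
      moreover have "i = 0" using L by simp
      hence "red w = \<gamma>" using L by (simp add: w_def)
      ultimately have iso: "order_iso w \<gamma>" using red_eq_\<gamma>_iff by blast
      hence "w ! 0 < w ! (k + 1)"
        using order_iso_nth_less[OF iso, of 0 "k + 1"] \<gamma>_nth by simp
      moreover have "w ! 0 = N" "w ! (k + 1) = \<beta> ! k" by (simp_all add: w_def)
      moreover have "\<beta> ! k \<in> set \<beta>" using L by auto
      ultimately show False using props(3)[of N] by fastforce
    qed
    hence "mch \<gamma> ([N] @ \<beta>) = mch \<gamma> [N] + mch \<gamma> \<beta>"
      unfolding mch_append by (simp only: Collect_empty_eq simp_thms) simp
    thus ?thesis by (simp add: mch_short)
  qed
  also have "mch \<gamma> u = mch \<gamma> \<alpha>" by (simp add: u_def mch_map_add)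
  finally show ?thesis by (simp add: g)
qed

text \<open>If the window had two or more letters in \<open>v\<close>, its entry at
  \<open>k + 1\<close> would lie in \<open>v\<close> and yet exceed its first entry, which lies in
  \<open>u\<close>. So a single letter of \<open>v\<close> remains, playing the final 1.\<close>

lemma straddling_skew:
  assumes d: "distinct (u @ v)" and gt: "\<And>a b. a \<in> set u \<Longrightarrow> b \<in> set v \<Longrightarrow> b < a"
    and v: "v \<noteq> []" "length v < k + 3"
  shows "i < length u \<and> length u < i + length \<gamma> \<and> i + length \<gamma> \<le> length u + length v \<and>
           red (take (length \<gamma>) (drop i (u @ v))) = \<gamma> \<longleftrightarrow>
         i + (k + 2) = length u \<and> suffix_iso p2 u" (is "?L \<longleftrightarrow> ?R")
proof -
  define w where "w = take (k + 3) (drop i (u @ v))"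
  have "distinct w" using d by (simp add: w_def distinct_take distinct_drop del: drop_append take_append)
  hence red: "red w = \<gamma> \<longleftrightarrow> order_iso w \<gamma>" by (rule red_eq_\<gamma>_iff)
  have main: "order_iso w \<gamma> \<longleftrightarrow> suffix_iso p2 u" if i: "i + (k + 2) = length u"
  proof -
    obtain b v' where b: "v = b # v'" using \<open>v \<noteq> []\<close> by (cases v) auto
    have len: "length (drop i u) = k + 2" using i by simp
    have w: "w = drop i u @ [b]" using i len by (simp add: w_def b)
    have "order_iso w \<gamma> \<longleftrightarrow> order_iso (drop i u) p2"
      unfolding w using len gt[of _ b] by (intro order_iso_\<gamma>_snoc) (auto simp: b dest: in_set_dropD)
    also have "\<dots> \<longleftrightarrow> suffix_iso p2 u"
      unfolding suffix_iso_def length_p using i by (simp flip: i)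
    finally show ?thesis .
  qed
  show ?thesis
  proof
    assume L: ?L
    hence iso: "order_iso w \<gamma>" using red unfolding w_def length_p by blast
    have "i + (k + 2) = length u"
    proof (rule ccontr)
      assume "i + (k + 2) \<noteq> length u"
      hence l: "length u \<le> i + (k + 1)" using L by simp
      have "w ! 0 < w ! (k + 1)"
        using order_iso_nth_less[OF iso, of 0 "k + 1"] \<gamma>_nth by simp
      moreover have w: "w ! j = (u @ v) ! (i + j)" if "j < k + 3" for j
        unfolding w_def using that L by (simp del: drop_append take_append)
      moreover have "w ! 0 = u ! i" using L w[of 0] by (simp add: nth_append)
      moreover have "w ! (k + 1) = v ! (i + (k + 1) - length u)"
        using l w[of "k + 1"] by (simp add: nth_append)
      moreover have "v ! (i + (k + 1) - length u) \<in> set v" using L l by (intro nth_mem) auto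
      ultimately show False using gt[of "u ! i"] L by fastforce
    qed
    thus ?R using main iso by simp
  next
    assume R: ?R
    have "length v \<ge> 1" using v by (cases v) auto
    thus ?L unfolding length_p w_def[symmetric] using R main red by auto
  qed
qed

lemma mch_skew_\<tau>:
  assumes "\<rho> \<in> Av n"
  shows "mch \<gamma> (skew \<rho> \<tau>) = mch \<gamma> \<rho> + (if suffix_iso p2 \<rho> then 1 else 0)"
proof -
  define u where "u = map (\<lambda>a. a + length \<tau>) \<rho>"
  have s: "skew \<rho> \<tau> = u @ \<tau>" by (simp add: u_def skew_def)
  have d: "distinct (u @ \<tau>)" using skew_Av[OF assms \<tau>] by (simp add: s mem_Av_iff)
  have gt: "b < a" if "a \<in> set u" "b \<in> set \<tau>" for a b
    using that assms \<tau> length_\<tau> by (auto simp: u_def mem_Av_iff)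
  \<comment> \<open>Positivity of \<open>k\<close> supplies the first letter of \<tau>, which plays
    the final 1 of \<gamma>.\<close>
  have ne: "\<tau> \<noteq> []" "length \<tau> < k + 3" using length_\<tau> k by auto
  have "mch \<gamma> (u @ \<tau>) = mch \<gamma> u + mch \<gamma> \<tau> + card {i. i + (k + 2) = length u \<and> suffix_iso p2 u}"
    unfolding mch_append
    by (intro arg_cong2[where f = "(+)"] arg_cong[where f = card] Collect_cong
          straddling_skew[OF d gt ne] refl)
  also have "card {i. i + (k + 2) = length u \<and> suffix_iso p2 u} = (if suffix_iso p2 \<rho> then 1 else 0)"
    using suffix_iso_length[of p2 \<rho>]
    unfolding card_Collect_eq_conj u_def suffix_iso_map_add by auto
  also have "mch \<gamma> \<tau> = 0" by (rule mch_short) (simp add: length_\<tau>)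
  also have "mch \<gamma> u = mch \<gamma> \<rho>" by (simp add: u_def mch_map_add)
  finally show ?thesis by (simp add: s)
qed

section \<open>Avoiders ending in an occurrence of \<open>p1\<close> or \<open>p2\<close>\<close>

lemma suffix_iso_p1_skew:
  assumes "\<rho> \<in> Av n" "0 < n"
  shows "suffix_iso p1 (skew \<rho> \<tau>)"
proof -
  have "\<rho> \<noteq> []" using assms length_Av by fastforce
  then obtain \<rho>' r where \<rho>: "\<rho> = \<rho>' @ [r]" by (metis rev_exhaust)
  have "r \<in> set \<rho>" by (simp add: \<rho>)
  hence r: "0 < r" using assms(1) by (simp add: mem_Av_iff)
  have "skew \<rho> \<tau> = map (\<lambda>a. a + k) \<rho>' @ ((r + k) # \<tau>)"
    by (simp add: \<rho> skew_def length_\<tau>)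
  \<comment> \<open>The raised last letter \<open>r + k\<close> exceeds all of \<tau> because
    \<open>0 < r\<close>, just as the first letter of \<open>p1\<close> exceeds the others.\<close>
  moreover have "order_iso ((r + k) # \<tau>) p1"
  proof -
    have b: "\<tau> ! i \<le> k" if "i < k" for i
      using nth_mem[of i \<tau>] \<tau> that length_\<tau> by (auto simp: mem_Av_iff)
    have "order_iso \<tau> (map Suc \<tau>)" by (simp add: order_iso_def)
    moreover have "(r + k < \<tau> ! i \<longleftrightarrow> k + 2 < map Suc \<tau> ! i) \<and> (\<tau> ! i < r + k \<longleftrightarrow> map Suc \<tau> ! i < k + 2)"
      if "i < length (map Suc \<tau>)" for i
      using b[of i] that r length_\<tau> by simp
    ultimately show ?thesis unfolding p1_def order_iso_Cons by blast
  qed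
  ultimately show ?thesis
    by (simp add: suffix_iso_append length_\<tau>)
qed

text \<open>
  The letters before a final occurrence of \<open>p1\<close> exceed all letters after its first letter, since
  otherwise they would play the 1 of a 132 whose 3 is the first letter of the occurrence.
\<close>

lemma suffix_iso_p1_obtain:
  assumes \<sigma>: "\<sigma> \<in> Av n" and suf: "suffix_iso p1 \<sigma>"
  obtains \<rho> where "k < n" "\<rho> \<in> Av (n - k)" "\<sigma> = skew \<rho> \<tau>"
proof -
  have n: "length \<sigma> = n" using \<sigma> by (rule length_Av)
  hence kn: "k < n" using suffix_iso_length[OF suf] by simp
  define s where "s = drop (n - (k + 1)) \<sigma>"
  have iso: "order_iso s p1" using suf by (simp add: suffix_iso_def s_def n)
  hence "length s = k + 1" by (simp add: order_iso_length)
  then obtain a v where s: "s = a # v" and v: "length v = k" by (cases s) auto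
  define u where "u = take (n - (k + 1)) \<sigma>"
  have \<sigma>_eq: "\<sigma> = u @ a # v" by (simp add: u_def s[symmetric] s_def)
  have isov: "order_iso v (map Suc \<tau>)"
    and cmp: "\<And>i. i < k \<Longrightarrow> v ! i < a \<longleftrightarrow> map Suc \<tau> ! i < k + 2"
    using iso unfolding s p1_def order_iso_Cons by (auto simp: length_\<tau>)
  have av: "b < a" if b: "b \<in> set v" for b
  proof -
    obtain i where i: "i < k" "b = v ! i" using b v by (auto simp: in_set_conv_nth)
    have "\<tau> ! i \<le> k" using nth_mem[of i \<tau>] \<tau> i length_\<tau> by (auto simp: mem_Av_iff)
    thus ?thesis using cmp[of i] i length_\<tau> by simp
  qed
  have mem: "distinct \<sigma>" "no_132 \<sigma>" using \<sigma> by (simp_all add: mem_Av_iff)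
  have gt: "b < c" if c: "c \<in> set (u @ [a])" and b: "b \<in> set v" for c b
  proof (cases "c = a")
    case False
    hence "subseq ([c] @ [a] @ [b]) (u @ [a] @ v)"
      using c b by (intro list_emb_append_mono) (auto simp: subseq_singleton_left)
    hence "subseq [c, a, b] \<sigma>" by (simp add: \<sigma>_eq)
    hence "\<not> (c < b \<and> b < a)" using mem(2) unfolding no_132_def by blast
    moreover have "c \<noteq> b" using c b False mem(1) by (auto simp: \<sigma>_eq)
    ultimately show ?thesis using av[OF b] by auto
  qed (use av b in simp)
  have "(u @ [a]) @ v \<in> Av n" using \<sigma> \<sigma>_eq by simp
  then obtain \<rho> where \<rho>: "\<rho> \<in> Av (length (u @ [a]))" "v \<in> Av (length v)" "(u @ [a]) @ v = skew \<rho> v"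
    using gt by (rule Av_append_decreasing)
  \<comment> \<open>As the lower summand, \<open>v\<close> is itself a permutation of an initial
    interval, so order isomorphism to \<tau> becomes equality.\<close>
  have "order_iso (map Suc \<tau>) \<tau>" by (simp add: order_iso_def)
  hence "order_iso v \<tau>" using isov order_iso_trans by blast
  hence "v = \<tau>"
    using \<rho>(2) \<tau> order_iso_permutations_eq by (auto simp: Av_def avoiding_perms_def)
  moreover have "length (u @ [a]) = n - k" using n v \<sigma>_eq by simp
  ultimately show thesis using that[of \<rho>] \<rho> kn \<sigma>_eq by simp
qed

text \<open>The pattern \<open>p2\<close> ends in its maximum. For empty \<beta> the final letter is
  the overall maximum and can be peeled off; otherwise the maximum of the word is not last, so the
  suffix must avoid it and lie within \<beta>.\<close>

lemma suffix_iso_p2_glue: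
  assumes "\<alpha> \<in> Av a" "\<beta> \<in> Av b"
  shows "suffix_iso p2 (glue \<alpha> \<beta>) \<longleftrightarrow> (if \<beta> = [] then suffix_iso p1 \<alpha> else suffix_iso p2 \<beta>)"
proof (cases "\<beta> = []")
  case True
  define l where "l = length \<alpha> - (k + 1)"
  define N where "N = Suc (length \<alpha>)"
  have g: "glue \<alpha> [] = \<alpha> @ [N]" by (simp add: True glue_conv N_def)
  have lt: "z < N" if "z \<in> set \<alpha>" for z
    using glue_properties(2)[OF assms, of z] that by (simp add: True N_def)
  show ?thesis
  proof (cases "k + 1 \<le> length \<alpha>")
    case True
    hence "drop (length (glue \<alpha> []) - length p2) (glue \<alpha> []) = drop l \<alpha> @ [N]"
      by (simp add: g l_def)
    moreover have "order_iso (drop l \<alpha> @ [N]) p2 \<longleftrightarrow> order_iso (drop l \<alpha>) p1"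
      using True lt by (intro order_iso_p2_snoc) (auto simp: l_def dest: in_set_dropD)
    ultimately show ?thesis using \<open>\<beta> = []\<close> by (simp add: suffix_iso_def l_def)
  next
    case False
    thus ?thesis
      using suffix_iso_length[of p2 "glue \<alpha> []"] suffix_iso_length[of p1 \<alpha>] \<open>\<beta> = []\<close>
      by (auto simp: g)
  qed
next
  case False
  define u where "u = map (\<lambda>a. a + length \<beta>) \<alpha>"
  define N where "N = Suc (length \<alpha> + length \<beta>)"
  have g: "glue \<alpha> \<beta> = u @ N # \<beta>" by (simp add: u_def N_def glue_conv)
  show ?thesis
  proof (cases "k + 2 \<le> length \<beta>")
    case True
    thus ?thesis using False suffix_iso_append_long[of p2 \<beta> "u @ [N]"] by (simp add: g)
  next
    case short: False
    have "\<not> suffix_iso p2 (glue \<alpha> \<beta>)"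
    proof
      assume suf: "suffix_iso p2 (glue \<alpha> \<beta>)"
      define w where "w = drop (length (glue \<alpha> \<beta>) - (k + 2)) (glue \<alpha> \<beta>)"
      have iso: "order_iso w p2" using suf by (simp add: suffix_iso_def w_def)
      \<comment> \<open>\<open>q\<close> is the position of the maximum \<open>N\<close> in
        \<open>w\<close>; since \<beta> is nonempty, it precedes the last position
        \<open>k + 1\<close>.\<close>
      define q where "q = k + 1 - length \<beta>"
      have q: "q < k + 1" "q + length \<beta> = k + 1" using short False by (auto simp: q_def)
      have len: "k + 2 \<le> length u + 1 + length \<beta>" using suffix_iso_length[OF suf] by (simp add: g)
      define j where "j = length u + 1 + length \<beta> - (k + 2)"
      have j: "j + q = length u" using len q by (auto simp: j_def)
      have w: "w = drop j (u @ N # \<beta>)" by (simp add: w_def g j_def)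
      have "w ! q = (u @ N # \<beta>) ! (j + q)"
        unfolding w using j by (subst nth_drop) auto
      hence "w ! q = N" using j by simp
      moreover have "w ! (k + 1) = \<beta> ! (length \<beta> - 1)"
      proof -
        have "j + (k + 1) = length u + Suc (length \<beta> - 1)" using j q False by (cases \<beta>) auto
        moreover have "w ! (k + 1) = (u @ N # \<beta>) ! (j + (k + 1))"
          unfolding w using j q by (subst nth_drop) auto
        ultimately show ?thesis by (simp only: nth_append_length_plus nth_Cons_Suc)
      qed
      moreover have "w ! q < w ! (k + 1)"
        using order_iso_nth_less[OF iso, of q "k + 1"] p2_nth q by simp
      moreover have "\<beta> ! (length \<beta> - 1) \<in> set \<beta>" using False by simp
      ultimately show False
        using glue_properties(3)[OF assms, of N "\<beta> ! (length \<beta> - 1)"] by (simp add: N_def)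
    qed
    thus ?thesis using False short suffix_iso_length[of p2 \<beta>] by auto
  qed
qed

section \<open>Weights and the equations between their series\<close>

definition wt :: "nat list \<Rightarrow> int poly" where "wt \<sigma> = monom 1 (mch \<gamma> \<sigma>)"
definition wt_nonempty :: "nat list \<Rightarrow> int poly" where
  "wt_nonempty \<sigma> = (if \<sigma> \<noteq> [] then wt \<sigma> else 0)"
definition wt_p1 :: "nat list \<Rightarrow> int poly" where
  "wt_p1 \<sigma> = (if suffix_iso p1 \<sigma> then wt \<sigma> else 0)"
definition wt_p2 :: "nat list \<Rightarrow> int poly" where
  "wt_p2 \<sigma> = (if suffix_iso p2 \<sigma> then wt \<sigma> else 0)"
text \<open>Writing the factor \<open>x\<close> of an extra occurrence as \<open>1 + y\<close> turns
  case distinctions into sums of products, the shape required by \<open>Av_gf_glue\<close>.\<close>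

definition y :: "int poly" where "y = monom 1 1 - 1"

lemma wt_Nil: "wt [] = 1" "wt_nonempty [] = 0" "wt_p2 [] = 0"
  using suffix_iso_length[of p2 "[]"]
  by (auto simp: wt_def wt_nonempty_def wt_p2_def mch_short)

lemma wt_glue:
  assumes "\<alpha> \<in> Av a" "\<beta> \<in> Av b"
  shows "wt (glue \<alpha> \<beta>) = wt \<alpha> * wt \<beta> + y * wt_p1 \<alpha> * wt_nonempty \<beta>"
  unfolding wt_def wt_p1_def wt_nonempty_def y_def mch_glue[OF assms]
  by (simp add: mult_monom algebra_simps)

text \<open>For empty \<beta> only the first product survives, as \<open>wt_p2 [] = 0\<close>; for
  nonempty \<beta> it vanishes, and the other two expand the weight of the glued word.\<close>

lemma wt_p2_glue:
  assumes "\<alpha> \<in> Av a" "\<beta> \<in> Av b"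
  shows "wt_p2 (glue \<alpha> \<beta>) =
           wt_p1 \<alpha> * (if \<beta> = [] then 1 else 0) + wt \<alpha> * wt_p2 \<beta> + y * wt_p1 \<alpha> * wt_p2 \<beta>"
proof (cases "\<beta> = []")
  case True
  thus ?thesis
    using wt_glue[OF assms] suffix_iso_p2_glue[OF assms] wt_Nil
    by (simp add: wt_p2_def wt_p1_def)
next
  case False
  thus ?thesis
    by (simp add: wt_p2_def suffix_iso_p2_glue[OF assms] wt_glue[OF assms] wt_nonempty_def)
qed

text \<open>The form with \<open>wt_nonempty\<close> gives 0 at the empty word, which is what the
  coefficient \<open>n = k\<close> in the series for \<open>wt_p1\<close> requires.\<close>

lemma wt_skew_\<tau>:
  assumes "\<rho> \<in> Av n" "0 < n"
  shows "wt (skew \<rho> \<tau>) = wt_nonempty \<rho> + y * wt_p2 \<rho>"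
proof -
  have "\<rho> \<noteq> []" using assms length_Av by fastforce
  thus ?thesis
    unfolding wt_def wt_p2_def wt_nonempty_def y_def mch_skew_\<tau>[OF assms(1)]
    by (simp add: mult_monom algebra_simps)
qed

lemma Av_gf_nonempty: "Av_gf wt_nonempty = Av_gf wt - 1"
proof -
  have "wt = (\<lambda>\<sigma>. wt_nonempty \<sigma> + (if \<sigma> = [] then 1 else 0))"
    by (auto simp: wt_nonempty_def wt_Nil)
  hence "Av_gf wt = Av_gf wt_nonempty + Av_gf (\<lambda>\<sigma>. if \<sigma> = [] then 1 else 0)"
    by (metis Av_gf_add)
  thus ?thesis by (simp add: Av_gf_Nil)
qed

lemma wt_gf_eq:
  "Av_gf wt = 1 + fps_X * (Av_gf wt * Av_gf wt + fps_const y * Av_gf wt_p1 * (Av_gf wt - 1))"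
proof -
  have "Av_gf wt = fps_const (wt []) + fps_X * (Av_gf wt * Av_gf wt +
          Av_gf (\<lambda>\<alpha>. y * wt_p1 \<alpha>) * Av_gf wt_nonempty + Av_gf (\<lambda>_. 0) * Av_gf (\<lambda>_. 0))"
    by (rule Av_gf_glue) (simp add: wt_glue)
  moreover have "Av_gf (\<lambda>_. 0) = 0" by (simp add: Av_gf_def fps_eq_iff)
  ultimately show ?thesis
    by (simp add: wt_Nil Av_gf_cmult Av_gf_nonempty)
qed

lemma wt_p2_gf_eq:
  "Av_gf wt_p2 = fps_X * (Av_gf wt_p1 + Av_gf wt * Av_gf wt_p2 +
                          fps_const y * Av_gf wt_p1 * Av_gf wt_p2)"
proof -
  have "Av_gf wt_p2 = fps_const (wt_p2 []) + fps_X *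
          (Av_gf wt_p1 * Av_gf (\<lambda>\<sigma>. if \<sigma> = [] then 1 else 0) + Av_gf wt * Av_gf wt_p2 +
           Av_gf (\<lambda>\<alpha>. y * wt_p1 \<alpha>) * Av_gf wt_p2)"
    by (rule Av_gf_glue) (simp add: wt_p2_glue)
  thus ?thesis
    by (simp add: wt_Nil Av_gf_cmult Av_gf_Nil)
qed

lemma wt_p1_gf_eq:
  "Av_gf wt_p1 = fps_X ^ k * (Av_gf wt - 1 + fps_const y * Av_gf wt_p2)"
proof -
  define h where "h = (\<lambda>\<sigma>. wt_nonempty \<sigma> + y * wt_p2 \<sigma>)"
  have "Av_gf wt_p1 = fps_X ^ k * Av_gf h"
  proof (rule fps_ext)
    fix n
    have "fps_nth (Av_gf wt_p1) n = (\<Sum>\<sigma>\<in>{\<sigma> \<in> Av n. suffix_iso p1 \<sigma>}. wt \<sigma>)"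
      by (simp add: Av_gf_def wt_p1_def sum.inter_filter finite_Av)
    also have "\<dots> = fps_nth (fps_X ^ k * Av_gf h) n"
    proof (cases "k < n")
      case True
      \<comment> \<open>Together with the injectivity below, placing \<tau> under \<rho> is a
        bijection onto the avoiders ending in an occurrence of \<open>p1\<close>.\<close>
      have "{\<sigma> \<in> Av n. suffix_iso p1 \<sigma>} = (\<lambda>\<rho>. skew \<rho> \<tau>) ` Av (n - k)"
      proof (intro equalityI subsetI)
        fix \<sigma> assume "\<sigma> \<in> {\<sigma> \<in> Av n. suffix_iso p1 \<sigma>}"
        hence "\<sigma> \<in> Av n" "suffix_iso p1 \<sigma>" by simp_all
        then obtain \<rho> where "\<rho> \<in> Av (n - k)" "\<sigma> = skew \<rho> \<tau>"
          by (rule suffix_iso_p1_obtain)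
        thus "\<sigma> \<in> (\<lambda>\<rho>. skew \<rho> \<tau>) ` Av (n - k)" by blast
      next
        fix \<sigma> assume "\<sigma> \<in> (\<lambda>\<rho>. skew \<rho> \<tau>) ` Av (n - k)"
        then obtain \<rho> where \<rho>: "\<rho> \<in> Av (n - k)" "\<sigma> = skew \<rho> \<tau>" by blast
        thus "\<sigma> \<in> {\<sigma> \<in> Av n. suffix_iso p1 \<sigma>}"
          using skew_Av[OF \<rho>(1) \<tau>] suffix_iso_p1_skew[OF \<rho>(1)] True by simp
      qed
      moreover have "inj_on (\<lambda>\<rho>. skew \<rho> \<tau>) (Av (n - k))"
        by (rule inj_onI) (auto simp: skew_def inj_on_def dest!: map_injective)
      ultimately have "(\<Sum>\<sigma>\<in>{\<sigma> \<in> Av n. suffix_iso p1 \<sigma>}. wt \<sigma>) = (\<Sum>\<rho>\<in>Av (n - k). wt (skew \<rho> \<tau>))"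
        by (simp add: sum.reindex)
      also have "\<dots> = (\<Sum>\<rho>\<in>Av (n - k). h \<rho>)"
        using True by (intro sum.cong) (auto simp: wt_skew_\<tau> h_def)
      finally show ?thesis using True by (simp add: fps_X_power_mult_nth Av_gf_def)
    next
      case False
      \<comment> \<open>For \<open>n \<le> k\<close> no word can contain \<open>p1\<close>, which
        has \<open>k + 1\<close> letters. The other side vanishes too: at \<open>n = k\<close>
        because both summands of \<open>h\<close> are 0 on the empty word.\<close>
      hence "{\<sigma> \<in> Av n. suffix_iso p1 \<sigma>} = {}" using suffix_iso_p1_obtain by blast
      hence "(\<Sum>\<sigma>\<in>{\<sigma> \<in> Av n. suffix_iso p1 \<sigma>}. wt \<sigma>) = 0" by (simp only: sum.empty)
      also have "0 = fps_nth (fps_X ^ k * Av_gf h) n"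
        using False by (auto simp: fps_X_power_mult_nth Av_gf_def Av_0 h_def wt_Nil)
      finally show ?thesis .
    qed
    finally show "fps_nth (Av_gf wt_p1) n = fps_nth (fps_X ^ k * Av_gf h) n" .
  qed
  also have "Av_gf h = Av_gf wt - 1 + fps_const y * Av_gf wt_p2"
    unfolding h_def by (simp add: Av_gf_add Av_gf_cmult Av_gf_nonempty)
  finally show ?thesis .
qed

section \<open>Elimination of the auxiliary series\<close>

lemma Av_gf_wt: "Av_gf wt = mch_gf \<gamma>"
  by (simp add: Av_gf_def wt_def[abs_def] mch_gf_def Av_def)

text \<open>The recursion multiplied by \<open>B - 1\<close>, an identity of power series free of
  quotients.\<close>

lemma functional_equation:
  defines "B \<equiv> mch_gf \<gamma>"
  shows "B * (B - 1) =
           fps_X * B ^ 3 + fps_X ^ k * fps_const y * (B - 1) * (B - 1 - fps_X * B)"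
proof -
  define E F Y X where defs: "E = Av_gf wt_p1" "F = Av_gf wt_p2" "Y = fps_const y"
    "X = (fps_X :: int poly fps)"
  define s where "s = X ^ k"
  have 1: "B - 1 = X * (B * B + Y * E * (B - 1))"
    using wt_gf_eq unfolding Av_gf_wt defs B_def by (metis add_diff_cancel_left')
  have 2: "F = X * (E + B * F + Y * E * F)"
    using wt_p2_gf_eq unfolding Av_gf_wt defs B_def .
  have 3: "E = s * (B - 1 + Y * F)"
    using wt_p1_gf_eq unfolding Av_gf_wt defs B_def s_def .
  note zero = eq_iff_diff_eq_0[THEN iffD1]
  \<comment> \<open>Equation \<open>2\<close> times \<open>B - 1\<close> minus equation
    \<open>1\<close> times \<open>F\<close>: the terms in \<open>Y * E * F\<close> cancel, and so
    does the factor \<open>X\<close> afterwards.\<close>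
  have "X * (F * B) - X * (E * (B - 1)) =
          (F - X * (E + B * F + Y * E * F)) * (B - 1) - F * (B - 1 - X * (B * B + Y * E * (B - 1)))"
    by (simp add: algebra_simps)
  also have "\<dots> = 0"
    unfolding zero[OF 1] zero[OF 2] by simp
  finally have "F * B = E * (B - 1)" by (simp add: defs)
  hence 4: "F * B - E * (B - 1) = 0" by simp
  \<comment> \<open>Equation \<open>3\<close> times \<open>B\<close>, with \<open>F * B\<close>
    replaced by \<open>E * (B - 1)\<close>, leaves a linear equation for \<open>E\<close>.\<close>
  have "E * (B - s * Y * (B - 1)) - s * B * (B - 1) =
          (E - s * (B - 1 + Y * F)) * B + s * Y * (F * B - E * (B - 1))"
    by (simp add: algebra_simps)
  also have "\<dots> = 0"
    unfolding zero[OF 3] 4 by simp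
  finally have 5: "E * (B - s * Y * (B - 1)) - s * B * (B - 1) = 0" .
  \<comment> \<open>Multiplying equation \<open>1\<close> by the coefficient of \<open>E\<close>
    found above allows \<open>E\<close> to be eliminated without dividing.\<close>
  have "B * (B - 1) - (X * B ^ 3 + s * Y * (B - 1) * (B - 1 - X * B)) =
          (B - 1 - X * (B * B + Y * E * (B - 1))) * (B - s * Y * (B - 1)) +
          X * Y * (B - 1) * (E * (B - s * Y * (B - 1)) - s * B * (B - 1))"
    by (simp add: algebra_simps power3_eq_cube)
  also have "\<dots> = 0"
    unfolding zero[OF 1] 5 by simp
  finally have "B * (B - 1) = X * B ^ 3 + s * Y * (B - 1) * (B - 1 - X * B)" by simp
  thus ?thesis by (simp add: defs s_def)
qed

end

section \<open>From the hypotheses on the pattern to the recursion\<close>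

lemma pattern_obtain:
  assumes m: "0 < m" "m \<noteq> 3" and \<gamma>: "\<gamma> \<in> avoiding_perms m [1, 3, 2]"
    and nth: "\<gamma> ! 0 = m - 1" "\<gamma> ! (m - 2) = m" "\<gamma> ! (m - 1) = 1"
  obtains k \<tau> where "m = k + 3" "0 < k" "\<tau> \<in> Av k" "\<gamma> = (k + 2) # map Suc \<tau> @ [k + 3, 1]"
proof -
  have mem: "\<gamma> \<in> Av m" "set \<gamma> = {1..m}" "distinct \<gamma>" "no_132 \<gamma>"
    using \<gamma> mem_Av_iff[of \<gamma> m] by (simp_all add: Av_def)
  have len: "length \<gamma> = m" using mem(1) by (rule length_Av)
  \<comment> \<open>For \<open>m = 1\<close> or \<open>m = 2\<close>, truncated subtraction makes
    \<open>m - 2\<close> equal 0, so the first letter would be both \<open>m - 1\<close> and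
    \<open>m\<close>.\<close>
  have "m \<noteq> 1" "m \<noteq> 2" using nth by auto
  then obtain k where k: "m = k + 3" "0 < k"
    using m by (metis One_nat_def Suc_1 add_Suc_right add.right_neutral gr0_conv_Suc
        neq0_conv not0_implies_Suc numeral_3_eq_3 add.commute)
  define \<mu> where "\<mu> = take k (drop 1 \<gamma>)"
  have \<gamma>_eq: "\<gamma> = (k + 2) # \<mu> @ [k + 3, 1]"
  proof (rule nth_equalityI)
    show "length \<gamma> = length ((k + 2) # \<mu> @ [k + 3, 1])" using len k by (simp add: \<mu>_def)
    fix i assume "i < length \<gamma>"
    hence "i = 0 \<or> (\<exists>j<k. i = Suc j) \<or> i = k + 1 \<or> i = k + 2"
      using len k by (cases i) auto
    moreover have "length \<mu> = k" using len k by (simp add: \<mu>_def)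
    ultimately show "\<gamma> ! i = ((k + 2) # \<mu> @ [k + 3, 1]) ! i"
      using nth k len by (auto simp: nth_append \<mu>_def)
  qed
  \<comment> \<open>Removing the letters 1, \<open>k + 2\<close> and \<open>k + 3\<close> leaves the
    interval from 2 to \<open>k + 1\<close>, which lowering by one turns into
    \<open>{1..k}\<close>.\<close>
  have "set \<mu> = {1..k + 3} - {k + 2, k + 3, 1}"
    using mem(2,3) unfolding \<gamma>_eq k(1) by auto
  also have "\<dots> = Suc ` {1..k}" by (auto simp: image_Suc_atLeastAtMost)
  finally have s: "set \<mu> = Suc ` {1..k}" .
  define \<tau> where "\<tau> = map (\<lambda>a. a - 1) \<mu>"
  have \<mu>: "\<mu> = map Suc \<tau>"
    unfolding \<tau>_def map_map by (rule map_idI[symmetric]) (auto simp: s)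
  have "no_132 \<mu>" using mem(4) unfolding \<gamma>_eq
    by (metis append_Cons append_Nil no_132_appendD)
  hence "no_132 \<tau>" unfolding \<mu> using no_132_map_add[of 1 \<tau>] by simp
  moreover have "distinct \<tau>" using mem(3) unfolding \<gamma>_eq \<mu> by (simp add: distinct_map)
  moreover have "set \<tau> = {1..k}"
    using s unfolding \<mu> set_map by (rule inj_image_eq_iff[OF inj_Suc, THEN iffD1])
  ultimately have "\<tau> \<in> Av k" by (simp add: mem_Av_iff)
  thus thesis using that k \<gamma>_eq \<mu> by simp
qed

lemma to_fract_power: "to_fract (a ^ n) = to_fract a ^ n"
  by (induction n) simp_all

theorem theorem17:
  fixes m :: nat and \<gamma> :: "nat list"
    and B t x :: "int poly fps fract"
  assumes "0 < m"
    and "m \<noteq> 3"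
    and "\<gamma> \<in> avoiding_perms m [1, 3, 2]"
    and "\<gamma> ! 0 = m - 1"
    and "\<gamma> ! (m - 2) = m"
    and "\<gamma> ! (m - 1) = 1"
  defines "B \<equiv> gf_B \<gamma>" and "t \<equiv> var_t" and "x \<equiv> var_x"
  shows "B = t * B ^ 3 / (B - 1) + t ^ (m - 3) * (x - 1) * (B - 1 - t * B)"
proof -
  obtain k \<tau> where k: "m = k + 3" "0 < k" "\<tau> \<in> Av k" and \<gamma>: "\<gamma> = (k + 2) # map Suc \<tau> @ [k + 3, 1]"
    using pattern_obtain[OF assms(1-6)] .
  interpret P: pattern_132 k \<tau> by unfold_locales fact+
  have P\<gamma>: "P.\<gamma> = \<gamma>" by (simp add: \<gamma> P.\<gamma>_def P.p1_def P.p2_def)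
  define G where "G = mch_gf \<gamma>"
  have y: "to_fract (fps_const P.y) = x - 1"
    by (simp add: P.y_def x_def fps_const_sub[symmetric] del: fps_const_sub)
  have "to_fract (G * (G - 1)) = to_fract (fps_X * G ^ 3 +
          fps_X ^ k * fps_const P.y * (G - 1) * (G - 1 - fps_X * G))"
    using P.functional_equation by (simp add: P\<gamma> G_def)
  hence eq: "B * (B - 1) = t * B ^ 3 + t ^ k * (x - 1) * (B - 1) * (B - 1 - t * B)"
    by (simp add: y to_fract_power B_def t_def G_def)
  \<comment> \<open>The coefficient of \<open>t\<close> is a nonzero monomial, coming from the
    single permutation of length 1, whereas the series 1 has coefficient 0 there. Hence
    \<open>B \<noteq> 1\<close> and \<open>B - 1\<close> can be inverted.\<close>
  have "\<sigma> = [1]" if \<sigma>: "\<sigma> \<in> Av 1" for \<sigma>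
  proof -
    obtain a where "\<sigma> = [a]"
      using length_Av[OF \<sigma>] by (metis One_nat_def length_0_conv length_Suc_conv)
    thus ?thesis using \<sigma> by (simp add: mem_Av_iff)
  qed
  moreover have "[1] \<in> Av 1" using Av_snoc[of "[]" 0] by (simp add: Av_0)
  ultimately have "Av 1 = {[1]}" by blast
  hence "fps_nth G 1 = monom 1 (mch \<gamma> [1])"
    by (simp add: G_def mch_gf_def Av_def)
  hence "fps_nth G 1 \<noteq> fps_nth 1 1" by simp
  hence "G \<noteq> 1" by metis
  hence "B \<noteq> 1" by (metis B_def G_def to_fract_1 to_fract_eq_iff)
  hence nz: "B - 1 \<noteq> 0" by simp
  have "B * (B - 1) = t * B ^ 3 / (B - 1) * (B - 1) + t ^ k * (x - 1) * (B - 1 - t * B) * (B - 1)"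
    unfolding eq using nz by (simp add: mult_ac)
  hence "B * (B - 1) = (t * B ^ 3 / (B - 1) + t ^ k * (x - 1) * (B - 1 - t * B)) * (B - 1)"
    by (simp only: distrib_right)
  thus ?thesis using nz k(1) by simp
qed

end
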